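(* Let $S$ and $S'$ be composition series of finite groups. Then $S \cong S'$ if and only if $X(S) \cong X(S')$ (as colored graphs).
   Context: All groups are finite. A composition series $S$ of a group $G$ is a maximal subnormal series $G_0 = 1 \triangleleft \cdots \triangleleft G_m = G$. Composition series $S$ of $G$ and $S'$ of $H$ (subgroups $H_0 = 1 \triangleleft \cdots \triangleleft H_{m'} = H$) are isomorphic, $S \cong S'$, if there is a group isomorphism $\phi : G \to H$ with $\phi[G_i] = H_i$ for each $i$ (in particular $m=m'$). $G/G_i$ denotes the set of left cosets of $G_i$ in $G$. The tree $T(S)$: the rooted tree with node set $\bigcup_i G/G_i$, root $G$, and an edge from each node $xG_{i+1} \in G/G_{i+1}$ to each $yG_i \in G/G_i$ with $yG_i \subseteq xG_{i+1}$. Its leaves are the nodes $\{x\} \in G/1$, identified with $x \in G$. Leaf product: $L(T)$ is the set of leaves (childless nodes) of a rooted tree $T$. For trees $T_1,T_2$ with roots $r_1,r_2$, $T_1 \odot T_2$ is the tree rooted at $r_1$ obtained by attaching to each leaf $x$ of $T_1$ a copy of $T_2$, with the root of the copy identified with $x$: its vertex set is $V(T_1) \cup \{(x,y) : x \in L(T_1),\ y \in V(T_2)\setminus\{r_2\}\}$, and its edges are $E(T_1)$, the pairs $(x,(x,y))$ with $x\in L(T_1)$, $(r_2,y) \in E(T_2)$, and the pairs $((x,y),(x,z))$ with $x\in L(T_1)$, $(y,z) \in E(T_2)$, $y,z \neq r_2$ (with the convention that $(x,r_2)$ means $x$). Leaf products are associative after identifying $(x,(y,z))$ and $((x,y),z)$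 with $(x,y,z)$. The graph $X(S)$: let $M$ be the tree consisting of a root connected to three nodes $\leftarrow$, $\rightarrow$, $=$ colored "left", "right", "equals" respectively. $X(S)$ is the colored (undirected) graph obtained from the tree $T(S) \odot T(S) \odot M$ by adding, for all $x,y \in G$, the path $((x,y,\leftarrow),(y,x,\rightarrow),(xy,y,=))$, i.e. the edges $\{(x,y,\leftarrow),(y,x,\rightarrow)\}$ and $\{(y,x,\rightarrow),(xy,y,=)\}$. Each leaf $(x,y,c)$ of $T(S)\odot T(S)\odot M$ has the color of $c$, and all other nodes are colored "internal". Colored graphs are isomorphic if there is a bijection of vertex sets respecting edges and colors. *)

theory Defs
  imports "HOL-Algebra.Left_Coset" "HOL-Library.Sublist"
begin

section \<open>Composition series\<close>

text \<open>A series \<open>G\<^sub>0 = 1, \<dots>, G\<^sub>m = G\<close> is the list of its \<open>m + 1\<close> terms; the terms are pairwise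
  distinct.\<close>

definition subnormal_series :: "('a, 'c) monoid_scheme \<Rightarrow> 'a set list \<Rightarrow> bool" where
  "subnormal_series G S \<longleftrightarrow>
     S \<noteq> [] \<and> hd S = {\<one>\<^bsub>G\<^esub>} \<and> last S = carrier G \<and>
     (\<forall>H \<in> set S. subgroup H G) \<and>
     (\<forall>i. Suc i < length S \<longrightarrow>
        S ! i \<lhd> G\<lparr>carrier := S ! Suc i\<rparr> \<and> S ! i \<noteq> S ! Suc i)"

text \<open>Maximality is with respect to refinement, i.e. insertion of further terms.\<close>

definition composition_series :: "('a, 'c) monoid_scheme \<Rightarrow> 'a set list \<Rightarrow> bool" where
  "composition_series G S \<longleftrightarrow>
     subnormal_series G S \<and>
     (\<forall>R. subnormal_series G R \<and> subseq S R \<longrightarrow> R = S)"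

definition series_isomorphic ::
  "('a, 'c) monoid_scheme \<Rightarrow> 'a set list \<Rightarrow> ('b, 'd) monoid_scheme \<Rightarrow> 'b set list \<Rightarrow> bool" where
  "series_isomorphic G S H S' \<longleftrightarrow>
     (\<exists>\<phi> \<in> iso G H. length S = length S' \<and> (\<forall>i < length S. \<phi> ` (S ! i) = S' ! i))"


section \<open>Rooted trees and leaf products\<close>

text \<open>Arcs point away from the root.\<close>

record 'v rooted_tree =
  nodes :: "'v set"
  root :: 'v
  arcs :: "('v \<times> 'v) set"

definition leaves :: "'v rooted_tree \<Rightarrow> 'v set" where
  "leaves T = {v \<in> nodes T. \<not> (\<exists>w. (v, w) \<in> arcs T)}"

text \<open>In the leaf product, \<open>Inl v\<close> is the node \<open>v\<close> of the first tree and \<open>Inr (x, y)\<close> is the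
  node \<open>(x, y)\<close> with \<open>y\<close> not the root of the second tree. The following function
  implements the convention that \<open>(x, y)\<close> means \<open>x\<close> if \<open>y\<close> is the root; this case does
  occur for leaves \<open>x, y\<close> when the second tree consists of its root only.\<close>

definition leaf_pair :: "'w rooted_tree \<Rightarrow> 'v \<Rightarrow> 'w \<Rightarrow> 'v + 'v \<times> 'w" where
  "leaf_pair T2 x y = (if y = root T2 then Inl x else Inr (x, y))"

definition leaf_product ::
  "'v rooted_tree \<Rightarrow> 'w rooted_tree \<Rightarrow> ('v + 'v \<times> 'w) rooted_tree"  (infixl \<open>\<odot>\<close> 70) where
  "T1 \<odot> T2 = \<lparr>
     nodes = Inl ` nodes T1 \<union> {Inr (x, y) | x y. x \<in> leaves T1 \<and> y \<in> nodes T2 - {root T2}},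
     root = Inl (root T1),
     arcs = {(Inl u, Inl v) | u v. (u, v) \<in> arcs T1}
       \<union> {(Inl x, Inr (x, y)) | x y. x \<in> leaves T1 \<and> (root T2, y) \<in> arcs T2}
       \<union> {(Inr (x, y), Inr (x, z)) | x y z.
            x \<in> leaves T1 \<and> (y, z) \<in> arcs T2 \<and> y \<noteq> root T2 \<and> z \<noteq> root T2}\<rparr>"


section \<open>The tree of a series\<close>

definition series_tree :: "('a, 'c) monoid_scheme \<Rightarrow> 'a set list \<Rightarrow> 'a set rooted_tree" where
  "series_tree G S = \<lparr>
     nodes = (\<Union>H \<in> set S. lcosets\<^bsub>G\<^esub> H),
     root = carrier G,
     arcs = {(A, B) | A B i. Suc i < length S \<and>
               A \<in> lcosets\<^bsub>G\<^esub> (S ! Suc i) \<and> B \<in> lcosets\<^bsub>G\<^esub> (S ! i) \<and> B \<subseteq> A}\<rparr>"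


section \<open>Colored graphs and the graph of a series\<close>

text \<open>Undirected edges are represented as unordered pairs \<open>{u, v}\<close>; colors are only relevant on
  vertices.\<close>

record ('v, 'k) colored_graph =
  vertices :: "'v set"
  edges :: "'v set set"
  color :: "'v \<Rightarrow> 'k"

definition colored_isomorphic ::
  "('v, 'k) colored_graph \<Rightarrow> ('w, 'k) colored_graph \<Rightarrow> bool" where
  "colored_isomorphic X Y \<longleftrightarrow>
     (\<exists>f. bij_betw f (vertices X) (vertices Y) \<and>
        (\<forall>u \<in> vertices X. \<forall>v \<in> vertices X. {u, v} \<in> edges X \<longleftrightarrow> {f u, f v} \<in> edges Y) \<and>
        (\<forall>u \<in> vertices X. color Y (f u) = color X u))"

datatype node_color = Internal | Left_Color | Right_Color | Equals_Color

datatype gadget_node = Gadget_Root | Left_Arrow | Right_Arrow | Equals_Sign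

definition gadget :: "gadget_node rooted_tree" where
  "gadget = \<lparr>
     nodes = {Gadget_Root, Left_Arrow, Right_Arrow, Equals_Sign},
     root = Gadget_Root,
     arcs = {(Gadget_Root, Left_Arrow), (Gadget_Root, Right_Arrow), (Gadget_Root, Equals_Sign)}\<rparr>"

fun gadget_color :: "gadget_node \<Rightarrow> node_color" where
  "gadget_color Left_Arrow = Left_Color"
| "gadget_color Right_Arrow = Right_Color"
| "gadget_color Equals_Sign = Equals_Color"
| "gadget_color Gadget_Root = Internal"

type_synonym 'a graph_node =
  "('a set + 'a set \<times> 'a set) + ('a set + 'a set \<times> 'a set) \<times> gadget_node"

definition series_graph_tree ::
  "('a, 'c) monoid_scheme \<Rightarrow> 'a set list \<Rightarrow> 'a graph_node rooted_tree" where
  "series_graph_tree G S = series_tree G S \<odot> series_tree G S \<odot> gadget"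

text \<open>The leaf \<open>(x, y, c)\<close> for group elements \<open>x, y\<close>, which are identified with the leaves
  \<open>{x}, {y}\<close> of the tree of the series.\<close>

definition triple_leaf ::
  "('a, 'c) monoid_scheme \<Rightarrow> 'a set list \<Rightarrow> 'a \<Rightarrow> 'a \<Rightarrow> gadget_node \<Rightarrow> 'a graph_node" where
  "triple_leaf G S x y c = leaf_pair gadget (leaf_pair (series_tree G S) {x} {y}) c"

text \<open>In the color function, \<open>Inr (p, c)\<close> is a leaf and \<open>Inl p\<close> is an internal node of
  the underlying tree.\<close>

definition series_graph ::
  "('a, 'c) monoid_scheme \<Rightarrow> 'a set list \<Rightarrow> ('a graph_node, node_color) colored_graph" where
  "series_graph G S = \<lparr>
     vertices = nodes (series_graph_tree G S),
     edges = {{u, v} | u v. (u, v) \<in> arcs (series_graph_tree G S)}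
       \<union> {{triple_leaf G S x y Left_Arrow, triple_leaf G S y x Right_Arrow} | x y.
            x \<in> carrier G \<and> y \<in> carrier G}
       \<union> {{triple_leaf G S y x Right_Arrow, triple_leaf G S (x \<otimes>\<^bsub>G\<^esub> y) y Equals_Sign} | x y.
            x \<in> carrier G \<and> y \<in> carrier G},
     color = (\<lambda>v. case v of Inl p \<Rightarrow> Internal | Inr (p, c) \<Rightarrow> gadget_color c)\<rparr>"

end

theory Submission
  imports Defs
begin

text \<open>
  An isomorphism of series acts on cosets, hence on all nodes of the graph. Conversely, measure the
  height of an internal node of \<open>X(S)\<close> from the leaves of \<open>T(S) \<odot> T(S)\<close>, which are the internal
  nodes with a neighbor that is not internal. Since all these leaves have the same depth \<open>2m\<close>, a
  neighbor of a node of height \<open>i\<close> is either its parent or one of its children, which have height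
  \<open>i - 1\<close>; so an isomorphism of colored graphs preserves heights and parents by induction on the
  height, and the root needs no separate argument. It therefore acts on the leaves \<open>(x, y)\<close> in a way
  that preserves having the same first component; the edges between left and right nodes make it
  commute with swapping the components, so it has the form \<open>(x, y) \<mapsto> (\<phi> x, \<phi> y)\<close>. The edges
  between right and equals nodes show that \<open>\<phi>\<close> is a homomorphism, and comparing ancestors at height
  \<open>m + j\<close> gives \<open>\<phi>[G\<^sub>j] = H\<^sub>j\<close>.
\<close>

subsection \<open>The graph of a chain of subgroups\<close>

text \<open>The ancestor at height \<open>i \<le> 2m\<close> of the leaf \<open>p\<close> of \<open>T(S) \<odot> T(S)\<close>, where \<open>m = length S - 1\<close>;
  at height \<open>m\<close> it is the root of the lower copy, represented as a leaf of the upper one.\<close>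

definition pair_node :: "('a, 'c) monoid_scheme \<Rightarrow> 'a set list \<Rightarrow> nat \<Rightarrow> 'a \<times> 'a
    \<Rightarrow> 'a set + 'a set \<times> 'a set" where
  "pair_node G S i p =
     (if i < length S - 1 then Inr ({fst p}, snd p <#\<^bsub>G\<^esub> S ! i)
      else Inl (fst p <#\<^bsub>G\<^esub> S ! (i - (length S - 1))))"

section \<open>Attaching the gadget below the leaves of a tree\<close>

lemma nodes_leaf_product_gadget:
  "nodes (T \<odot> gadget) =
     Inl ` nodes T \<union> {Inr (v, c) | v c. v \<in> leaves T \<and> c \<noteq> Gadget_Root}"
proof -
  have "nodes gadget - {root gadget} = {c. c \<noteq> Gadget_Root}"
    using gadget_node.exhaust by (auto simp: gadget_def)
  then show ?thesis by (auto simp: leaf_product_def)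
qed

lemma arcs_leaf_product_gadget:
  "arcs (T \<odot> gadget) = {(Inl u, Inl v) | u v. (u, v) \<in> arcs T} \<union>
     {(Inl v, Inr (v, c)) | v c. v \<in> leaves T \<and> c \<noteq> Gadget_Root}"
proof -
  have "(root gadget, c) \<in> arcs gadget \<longleftrightarrow> c \<noteq> Gadget_Root" for c
    by (cases c) (auto simp: gadget_def)
  moreover have "\<not> ((c, d) \<in> arcs gadget \<and> c \<noteq> root gadget \<and> d \<noteq> root gadget)" for c d
    by (auto simp: gadget_def)
  ultimately show ?thesis unfolding leaf_product_def rooted_tree.simps by blast
qed

section \<open>Strict chains of subgroups from 1 to a finite group, and their cosets\<close>

locale subgroup_series = group G for G (structure) +
  fixes S
  assumes finite_carrier: "finite (carrier G)"
    and S_nonempty: "S \<noteq> []"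
    and hd_S: "hd S = {\<one>}"
    and last_S: "last S = carrier G"
    and subgroup_S: "i < length S \<Longrightarrow> subgroup (S ! i) G"
    and strict_S: "Suc i < length S \<Longrightarrow> S ! i \<subset> S ! Suc i"
begin

lemma S_0: "S ! 0 = {\<one>}"
  using hd_S S_nonempty by (simp add: hd_conv_nth)

lemma S_last: "S ! (length S - 1) = carrier G"
  using last_S S_nonempty by (simp add: last_conv_nth)

lemma S_subset: "i < length S \<Longrightarrow> S ! i \<subseteq> carrier G"
  by (rule subgroup.subset[OF subgroup_S])

lemma card_S_less: "i < j \<Longrightarrow> j < length S \<Longrightarrow> card (S ! i) < card (S ! j)"
proof (induction j)
  case (Suc j)
  have "card (S ! j) < card (S ! Suc j)"
    using Suc.prems by (intro psubset_card_mono strict_S finite_subset[OF S_subset finite_carrier]) auto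
  with Suc show ?case by (cases "i = j") auto
qed simp

lemma card_coset: "i < length S \<Longrightarrow> x \<in> carrier G \<Longrightarrow> card (x <# S ! i) = card (S ! i)"
  by (rule l_card_cosets_equal[OF _ S_subset finite_carrier, symmetric]) (auto simp: LCOSETS_def)

text \<open>Left multiplication preserves cardinality, and in a finite group the cardinalities of
  the terms increase strictly. So a coset, taken as a bare set, determines its level, and the levels
  of the tree are disjoint.\<close>

lemma coset_eq_imp_index_eq:
  assumes "x <# S ! i = y <# S ! j" "i < length S" "j < length S" "x \<in> carrier G" "y \<in> carrier G"
  shows "i = j"
  using assms card_coset[of i x] card_coset[of j y] card_S_less[of i j] card_S_less[of j i]
  by (cases i j rule: linorder_cases) simp_all

lemma coset_0: "x \<in> carrier G \<Longrightarrow> x <# S ! 0 = {x}"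
  by (simp add: S_0 l_coset_def)

lemma coset_last: "x \<in> carrier G \<Longrightarrow> x <# S ! (length S - 1) = carrier G"
  using coset_join3[of x "carrier G"] by (simp add: S_last subgroup_self del: One_nat_def)

text \<open>The inclusion puts \<open>y\<close> into the coset of \<open>x\<close>, and a coset may
  be represented by any of its elements. This gives both ends of an arc a common
  representative.\<close>

lemma coset_subset_imp:
  assumes "y <# S ! i \<subseteq> x <# S ! j" "i < length S" "j < length S" "x \<in> carrier G" "y \<in> carrier G"
  shows "x <# S ! j = y <# S ! j"
proof (rule l_repr_independence[OF _ \<open>x \<in> carrier G\<close> subgroup_S])
  show "y \<in> x <# S ! j"
    using assms(1) lcos_self[OF assms(5) subgroup_S[OF assms(2)]] by blast
qed (fact assms)

lemma S_mono: "Suc i < length S \<Longrightarrow> S ! i \<subseteq> S ! Suc i"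
  using strict_S by blast

lemma coset_eq_mono:
  assumes "y <# S ! i = x <# S ! i" "Suc i < length S" "x \<in> carrier G" "y \<in> carrier G"
  shows "y <# S ! Suc i = x <# S ! Suc i"
proof -
  have "y <# S ! i \<subseteq> x <# S ! Suc i"
    using assms(1) S_mono[OF assms(2)] by (auto simp: l_coset_def)
  from coset_subset_imp[OF this] show ?thesis using assms by simp
qed

section \<open>The coset tree of a series\<close>

lemma nodes_series_tree:
  "nodes (series_tree G S) = {x <# S ! i | i x. i < length S \<and> x \<in> carrier G}"
  unfolding series_tree_def LCOSETS_def set_conv_nth by auto

text \<open>The representative of the child also represents the parent. With the common
  representative, a path from the root to a leaf is described by one group element.\<close>

lemma arcs_series_tree:
  "arcs (series_tree G S) =
     {(x <# S ! Suc i, x <# S ! i) | i x. Suc i < length S \<and> x \<in> carrier G}"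
proof -
  have sub: "x <# S ! i \<subseteq> x <# S ! Suc i" if "Suc i < length S" for i x
    using S_mono[OF that] by (auto simp: l_coset_def)
  show ?thesis (is "?L = ?R")
  proof (intro equalityI subsetI)
    fix e assume "e \<in> ?L"
    then obtain i x y where i: "Suc i < length S" "x \<in> carrier G" "y \<in> carrier G"
        and e: "e = (x <# S ! Suc i, y <# S ! i)" "y <# S ! i \<subseteq> x <# S ! Suc i"
      by (auto simp: series_tree_def LCOSETS_def)
    then have "e = (y <# S ! Suc i, y <# S ! i)"
      using coset_subset_imp[of y i x "Suc i"] by simp
    with i show "e \<in> ?R" by blast
  next
    fix e assume "e \<in> ?R"
    with sub show "e \<in> ?L" by (auto simp: series_tree_def LCOSETS_def)
  qed
qed

lemma coset_arc:
  "Suc i < length S \<Longrightarrow> x \<in> carrier G \<Longrightarrow>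
     (x <# S ! Suc i, x <# S ! i) \<in> arcs (series_tree G S)"
  unfolding arcs_series_tree by blast

lemma root_series_tree: "root (series_tree G S) = carrier G"
  by (simp add: series_tree_def)

lemma leaves_series_tree: "leaves (series_tree G S) = {{x} | x. x \<in> carrier G}"
proof -
  have "x <# S ! i \<in> leaves (series_tree G S) \<longleftrightarrow> i = 0" if "i < length S" "x \<in> carrier G" for i x
  proof -
    have "(\<exists>w. (x <# S ! i, w) \<in> arcs (series_tree G S)) \<longleftrightarrow> i \<noteq> 0"
    proof
      assume "\<exists>w. (x <# S ! i, w) \<in> arcs (series_tree G S)"
      then obtain j y where "x <# S ! i = y <# S ! Suc j" "Suc j < length S" "y \<in> carrier G"
        by (auto simp: arcs_series_tree)
      with that show "i \<noteq> 0" using coset_eq_imp_index_eq by blast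
    next
      assume "i \<noteq> 0"
      then obtain j where "i = Suc j" by (cases i) auto
      with that coset_arc show "\<exists>w. (x <# S ! i, w) \<in> arcs (series_tree G S)"
        by blast
    qed
    with that show ?thesis by (auto simp: leaves_def nodes_series_tree)
  qed
  then have "leaves (series_tree G S) = {x <# S ! 0 | x. x \<in> carrier G}"
    using S_nonempty unfolding leaves_def nodes_series_tree by blast
  also have "\<dots> = {{x} | x. x \<in> carrier G}"
    by (rule Collect_cong) (metis coset_0)
  finally show ?thesis .
qed

section \<open>Coordinates on \<open>T(S) \<odot> T(S)\<close>: a height and a leaf below the
  node\<close>

lemma coset_eq_root_iff:
  assumes "i < length S" "x \<in> carrier G"
  shows "x <# S ! i = carrier G \<longleftrightarrow> i = length S - 1"
  using assms coset_eq_imp_index_eq[of x i x "length S - 1"] coset_last by auto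

text \<open>The constructors \<open>Inr\<close> and \<open>Inl\<close> separate heights below
  \<open>length S - 1\<close> from the others, and on either side the level of the coset determines
  the height. What remains is equality of cosets at one height.\<close>

lemma pair_node_eq_iff:
  assumes "i \<le> 2 * (length S - 1)" "j \<le> 2 * (length S - 1)"
    "p \<in> carrier G \<times> carrier G" "q \<in> carrier G \<times> carrier G"
  shows "pair_node G S i p = pair_node G S j q \<longleftrightarrow> i = j \<and>
    (if i < length S - 1 then fst p = fst q \<and> snd p <# S ! i = snd q <# S ! i
     else fst p <# S ! (i - (length S - 1)) = fst q <# S ! (i - (length S - 1)))"
proof -
  have pq: "fst p \<in> carrier G" "snd p \<in> carrier G" "fst q \<in> carrier G" "snd q \<in> carrier G"
    using assms by auto
  have "i - (length S - 1) < length S" "j - (length S - 1) < length S"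
    using assms S_nonempty by (cases S; simp)+
  from coset_eq_imp_index_eq[OF _ this pq(1,3)]
  have outer: "i - (length S - 1) = j - (length S - 1)"
    if "fst p <# S ! (i - (length S - 1)) = fst q <# S ! (j - (length S - 1))"
    using that .
  have inner: "i = j" if "snd p <# S ! i = snd q <# S ! j" "i < length S - 1" "j < length S - 1"
    using coset_eq_imp_index_eq[OF that(1) _ _ pq(2,4)] that by simp
  have index: "i = j" if eq: "pair_node G S i p = pair_node G S j q"
  proof (cases "i < length S - 1 \<longleftrightarrow> j < length S - 1")
    case False
    with eq show ?thesis by (auto simp: pair_node_def split: if_splits)
  next
    case True
    show ?thesis
    proof (cases "i < length S - 1")
      case i: True
      with True eq have "snd p <# S ! i = snd q <# S ! j" by (simp add: pair_node_def)
      from inner[OF this i] show ?thesis using True i by simp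
    next
      case i: False
      with True eq have "fst p <# S ! (i - (length S - 1)) = fst q <# S ! (j - (length S - 1))"
        by (simp add: pair_node_def)
      \<comment> \<open>The truncated differences determine the heights because both heights are at
        least \<open>length S - 1\<close> here.\<close>
      from outer[OF this] show ?thesis using True i by linarith
    qed
  qed
  show ?thesis
  proof (cases "i = j")
    case True
    then show ?thesis by (simp add: pair_node_def)
  next
    case False
    with index show ?thesis by blast
  qed
qed

lemma pair_node_eq_imp_height_eq:
  assumes "pair_node G S i p = pair_node G S j q"
    "i \<le> 2 * (length S - 1)" "j \<le> 2 * (length S - 1)"
    "p \<in> carrier G \<times> carrier G" "q \<in> carrier G \<times> carrier G"
  shows "i = j"
  using assms(1) unfolding pair_node_eq_iff[OF assms(2-)] by blast

lemma pair_node_0_eq_iff: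
  assumes "p \<in> carrier G \<times> carrier G" "q \<in> carrier G \<times> carrier G"
  shows "pair_node G S 0 p = pair_node G S 0 q \<longleftrightarrow> p = q"
proof (cases "length S - 1 = 0")
  \<comment> \<open>For a series with one term, height 0 already falls into the \<open>Inl\<close>
    branch and forgets the second component; but then the group is trivial and there is only one
    pair.\<close>
  case True
  then have "carrier G = {\<one>}" using S_0 S_last by simp
  with assms show ?thesis by auto
next
  case False
  with assms show ?thesis
    by (auto simp: pair_node_def coset_0)
qed

text \<open>The two encodings switch to \<open>Inl\<close> under the same condition: the leaf
  \<open>{y}\<close> is the root of the second tree exactly when the series has a single
  term.\<close>

lemma leaf_pair_eq_pair_node:
  assumes "x \<in> carrier G" "y \<in> carrier G"
  shows "leaf_pair (series_tree G S) {x} {y} = pair_node G S 0 (x, y)"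
proof -
  have "{y} = carrier G \<longleftrightarrow> length S - 1 = 0"
    using coset_eq_root_iff[of 0 y] S_nonempty assms by (auto simp: coset_0)
  with assms show ?thesis
    by (simp add: leaf_pair_def pair_node_def root_series_tree coset_0)
qed

lemma nodes_pair_tree:
  "nodes (series_tree G S \<odot> series_tree G S) =
     {pair_node G S i p | i p. i \<le> 2 * (length S - 1) \<and> p \<in> carrier G \<times> carrier G}" (is "?L = ?R")
proof (intro equalityI subsetI)
  fix v assume "v \<in> ?L"
  then consider (outer) i x where "i < length S" "x \<in> carrier G" "v = Inl (x <# S ! i)"
    | (inner) i x y where "i < length S" "x \<in> carrier G" "y \<in> carrier G"
        "v = Inr ({x}, y <# S ! i)" "y <# S ! i \<noteq> carrier G"
    unfolding leaf_product_def nodes_series_tree leaves_series_tree root_series_tree rooted_tree.simps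
    by blast
  then show "v \<in> ?R"
  proof cases
    case outer
    \<comment> \<open>In the upper tree the second component is ignored, so \<open>x\<close> serves
      as a dummy.\<close>
    then have "v = pair_node G S (length S - 1 + i) (x, x)" by (simp add: pair_node_def)
    moreover have "length S - 1 + i \<le> 2 * (length S - 1)" using outer(1) by simp
    ultimately show ?thesis using outer(2) by blast
  next
    case inner
    then have "i < length S - 1" using coset_eq_root_iff[of i y] by auto
    with inner have "v = pair_node G S i (x, y)" "i \<le> 2 * (length S - 1)" by (auto simp: pair_node_def)
    then show ?thesis using inner by blast
  qed
next
  fix v assume "v \<in> ?R"
  then obtain i x y where i: "i \<le> 2 * (length S - 1)" "x \<in> carrier G" "y \<in> carrier G"
      and v: "v = pair_node G S i (x, y)" by auto
  show "v \<in> ?L"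
  proof (cases "i < length S - 1")
    case True
    then have "v = Inr ({x}, y <# S ! i)" "i < length S" "y <# S ! i \<noteq> carrier G"
      using v i coset_eq_root_iff[of i y] by (auto simp: pair_node_def)
    then show ?thesis using i
      by (auto simp: leaf_product_def nodes_series_tree leaves_series_tree root_series_tree)
  next
    case False
    then have "v = Inl (x <# S ! (i - (length S - 1)))" "i - (length S - 1) < length S"
      using v i S_nonempty by (auto simp: pair_node_def neq_Nil_conv)
    then show ?thesis using i
      unfolding leaf_product_def nodes_series_tree rooted_tree.simps by blast
  qed
qed

text \<open>The three kinds of arcs of a leaf product become one: arcs of a lower copy away from its
  root, arcs leaving the root of a copy, and arcs of the upper tree all lower the height by one
  above a fixed leaf.\<close>

lemma arcs_pair_tree:
  "arcs (series_tree G S \<odot> series_tree G S) =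
     {(pair_node G S (Suc i) p, pair_node G S i p) | i p.
        i < 2 * (length S - 1) \<and> p \<in> carrier G \<times> carrier G}" (is "?L = ?R")
proof (intro equalityI subsetI)
  fix e assume "e \<in> ?L"
  then consider (outer) A B where "(A, B) \<in> arcs (series_tree G S)" "e = (Inl A, Inl B)"
    | (middle) L B where "L \<in> leaves (series_tree G S)"
        "(carrier G, B) \<in> arcs (series_tree G S)" "e = (Inl L, Inr (L, B))"
    | (inner) L A B where "L \<in> leaves (series_tree G S)" "(A, B) \<in> arcs (series_tree G S)"
        "A \<noteq> carrier G" "e = (Inr (L, A), Inr (L, B))"
    unfolding leaf_product_def root_series_tree rooted_tree.simps by blast
  then show "e \<in> ?R"
  proof cases
    case outer
    then obtain i x where i: "Suc i < length S" "x \<in> carrier G"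
        and e: "e = (Inl (x <# S ! Suc i), Inl (x <# S ! i))"
      unfolding arcs_series_tree by blast
    have "e = (pair_node G S (Suc (length S - 1 + i)) (x, x), pair_node G S (length S - 1 + i) (x, x))"
      using e by (simp add: pair_node_def)
    moreover have "length S - 1 + i < 2 * (length S - 1)" using i(1) by simp
    ultimately show ?thesis using i(2) by blast
  next
    case middle
    from middle(2) obtain i y where i: "Suc i < length S" "y \<in> carrier G"
        "carrier G = y <# S ! Suc i" "B = y <# S ! i"
      unfolding arcs_series_tree by blast
    moreover obtain x where x: "x \<in> carrier G" "L = {x}"
      using middle(1) unfolding leaves_series_tree by blast
    \<comment> \<open>The whole group occurs as a coset only at the top level, so a middle arc
      starts exactly where the two trees are glued.\<close>
    moreover have "Suc i = length S - 1"
      using i coset_eq_root_iff[of "Suc i" y] by simp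
    ultimately have "e = (pair_node G S (Suc i) (x, y), pair_node G S i (x, y))"
      "i < 2 * (length S - 1)"
      using middle(3) by (simp_all add: pair_node_def coset_0)
    then show ?thesis using i x by blast
  next
    case inner
    from inner(2) obtain i y where i: "Suc i < length S" "y \<in> carrier G"
        "A = y <# S ! Suc i" "B = y <# S ! i"
      unfolding arcs_series_tree by blast
    moreover obtain x where x: "x \<in> carrier G" "L = {x}"
      using inner(1) unfolding leaves_series_tree by blast
    moreover have "Suc i \<noteq> length S - 1"
      using i inner(3) coset_last by metis
    then have "Suc i < length S - 1" using i(1) by simp
    ultimately have "e = (pair_node G S (Suc i) (x, y), pair_node G S i (x, y))"
      "i < 2 * (length S - 1)"
      using inner(4) by (simp_all add: pair_node_def)
    then show ?thesis using i x by blast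
  qed
next
  fix e assume "e \<in> ?R"
  then obtain i x y where i: "i < 2 * (length S - 1)" "x \<in> carrier G" "y \<in> carrier G"
      and e: "e = (pair_node G S (Suc i) (x, y), pair_node G S i (x, y))" by auto
  consider (inner) "Suc i < length S - 1" | (middle) "Suc i = length S - 1" | (outer) "i \<ge> length S - 1"
    by linarith
  then show "e \<in> ?L"
  proof cases
    case inner
    then have "e = (Inr ({x}, y <# S ! Suc i), Inr ({x}, y <# S ! i))"
      using e by (simp add: pair_node_def)
    moreover have "(y <# S ! Suc i, y <# S ! i) \<in> arcs (series_tree G S)"
      using inner i by (intro coset_arc) auto
    moreover have "y <# S ! Suc i \<noteq> carrier G" "y <# S ! i \<noteq> carrier G"
      using coset_eq_root_iff[of "Suc i" y] coset_eq_root_iff[of i y] inner i by auto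
    ultimately show ?thesis using i
      unfolding leaf_product_def leaves_series_tree root_series_tree rooted_tree.simps by blast
  next
    case middle
    then have "e = (Inl {x}, Inr ({x}, y <# S ! i))"
      using e i by (simp add: pair_node_def coset_0)
    moreover have "(carrier G, y <# S ! i) \<in> arcs (series_tree G S)"
      using coset_arc[of i y] coset_last[of y] middle i by simp
    ultimately show ?thesis using i
      unfolding leaf_product_def leaves_series_tree root_series_tree rooted_tree.simps by blast
  next
    case outer
    define j where "j = i - (length S - 1)"
    have "e = (Inl (x <# S ! Suc j), Inl (x <# S ! j))" "Suc j < length S"
      using outer e i by (auto simp: pair_node_def j_def Suc_diff_le)
    with coset_arc[of j x] i show ?thesis
      unfolding leaf_product_def rooted_tree.simps by blast
  qed
qed

lemma leaves_pair_tree: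
  "leaves (series_tree G S \<odot> series_tree G S) = pair_node G S 0 ` (carrier G \<times> carrier G)"
proof -
  have leaf_iff: "pair_node G S i p \<in> leaves (series_tree G S \<odot> series_tree G S) \<longleftrightarrow> i = 0"
    if i: "i \<le> 2 * (length S - 1)" and p: "p \<in> carrier G \<times> carrier G" for i p
  proof
    assume leaf: "pair_node G S i p \<in> leaves (series_tree G S \<odot> series_tree G S)"
    show "i = 0"
    proof (rule ccontr)
      assume "i \<noteq> 0"
      then obtain j where j: "i = Suc j" by (cases i) auto
      with i have "j < 2 * (length S - 1)" by simp
      with p have "(pair_node G S (Suc j) p, pair_node G S j p)
          \<in> arcs (series_tree G S \<odot> series_tree G S)"
        unfolding arcs_pair_tree by blast
      with leaf j show False by (auto simp: leaves_def)
    qed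
  next
    assume "i = 0"
    have "(pair_node G S 0 p, w) \<notin> arcs (series_tree G S \<odot> series_tree G S)" for w
    proof
      assume "(pair_node G S 0 p, w) \<in> arcs (series_tree G S \<odot> series_tree G S)"
      then obtain j q where "pair_node G S 0 p = pair_node G S (Suc j) q" "j < 2 * (length S - 1)"
          "q \<in> carrier G \<times> carrier G"
        unfolding arcs_pair_tree by blast
      then show False using pair_node_eq_imp_height_eq[of 0 p "Suc j" q] p by simp
    qed
    moreover have "pair_node G S 0 p \<in> nodes (series_tree G S \<odot> series_tree G S)"
      using p unfolding nodes_pair_tree by blast
    ultimately show "pair_node G S i p \<in> leaves (series_tree G S \<odot> series_tree G S)"
      using \<open>i = 0\<close> by (simp add: leaves_def)
  qed
  show ?thesis
  proof (intro equalityI subsetI)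
    fix v assume v: "v \<in> leaves (series_tree G S \<odot> series_tree G S)"
    then have "v \<in> nodes (series_tree G S \<odot> series_tree G S)" by (simp add: leaves_def)
    then obtain i p where "i \<le> 2 * (length S - 1)" "p \<in> carrier G \<times> carrier G"
        "v = pair_node G S i p"
      unfolding nodes_pair_tree by blast
    with v leaf_iff[of i p] show "v \<in> pair_node G S 0 ` (carrier G \<times> carrier G)" by blast
  next
    fix v assume "v \<in> pair_node G S 0 ` (carrier G \<times> carrier G)"
    with leaf_iff[of 0] show "v \<in> leaves (series_tree G S \<odot> series_tree G S)" by blast
  qed
qed

section \<open>Vertices, edges and adjacency of \<open>X(S)\<close> in these coordinates\<close>

lemma vertices_series_graph:
  "vertices (series_graph G S) =
     {Inl (pair_node G S i p) | i p. i \<le> 2 * (length S - 1) \<and> p \<in> carrier G \<times> carrier G} \<union>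
     {Inr (pair_node G S 0 p, c) | p c. p \<in> carrier G \<times> carrier G \<and> c \<noteq> Gadget_Root}"
  unfolding series_graph_def series_graph_tree_def colored_graph.simps
    nodes_leaf_product_gadget nodes_pair_tree leaves_pair_tree
  by blast

lemma edges_series_graph:
  "edges (series_graph G S) =
     {{Inl (pair_node G S (Suc i) p), Inl (pair_node G S i p)} | i p.
        i < 2 * (length S - 1) \<and> p \<in> carrier G \<times> carrier G} \<union>
     {{Inl (pair_node G S 0 p), Inr (pair_node G S 0 p, c)} | p c.
        p \<in> carrier G \<times> carrier G \<and> c \<noteq> Gadget_Root} \<union>
     {{Inr (pair_node G S 0 (x, y), Left_Arrow), Inr (pair_node G S 0 (y, x), Right_Arrow)} | x y.
        x \<in> carrier G \<and> y \<in> carrier G} \<union>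
     {{Inr (pair_node G S 0 (y, x), Right_Arrow), Inr (pair_node G S 0 (x \<otimes> y, y), Equals_Sign)} | x y.
        x \<in> carrier G \<and> y \<in> carrier G}" (is "_ = ?A \<union> ?B \<union> ?C \<union> ?D")
proof -
  have triple: "triple_leaf G S x y c = Inr (pair_node G S 0 (x, y), c)"
    if "x \<in> carrier G" "y \<in> carrier G" "c \<noteq> Gadget_Root" for x y c
    using that unfolding triple_leaf_def leaf_pair_eq_pair_node[OF that(1,2)]
    by (simp add: leaf_pair_def gadget_def)
  have "{{u, v} | u v. (u, v) \<in> arcs (series_graph_tree G S)} = ?A \<union> ?B"
    unfolding series_graph_tree_def arcs_leaf_product_gadget arcs_pair_tree leaves_pair_tree by blast
  moreover have "{{triple_leaf G S x y Left_Arrow, triple_leaf G S y x Right_Arrow} | x y.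
      x \<in> carrier G \<and> y \<in> carrier G} = ?C"
    by (intro Collect_cong ex_cong1) (auto simp: triple)
  moreover have "{{triple_leaf G S y x Right_Arrow, triple_leaf G S (x \<otimes> y) y Equals_Sign} | x y.
      x \<in> carrier G \<and> y \<in> carrier G} = ?D"
    by (intro Collect_cong ex_cong1) (auto simp: triple)
  ultimately show ?thesis
    unfolding series_graph_def by simp
qed

lemma color_series_graph:
  "color (series_graph G S) (Inl v) = Internal"
  "color (series_graph G S) (Inr (w, c)) = gadget_color c"
  by (simp_all add: series_graph_def)

lemma tree_edge:
  "i < 2 * (length S - 1) \<Longrightarrow> p \<in> carrier G \<times> carrier G \<Longrightarrow>
     {Inl (pair_node G S (Suc i) p), Inl (pair_node G S i p)} \<in> edges (series_graph G S)"
  unfolding edges_series_graph by (rule UnI1, rule UnI1, rule UnI1) blast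

lemma leaf_edge:
  "p \<in> carrier G \<times> carrier G \<Longrightarrow> c \<noteq> Gadget_Root \<Longrightarrow>
     {Inl (pair_node G S 0 p), Inr (pair_node G S 0 p, c)} \<in> edges (series_graph G S)"
  unfolding edges_series_graph by (rule UnI1, rule UnI1, rule UnI2) blast

lemma left_right_edge:
  "x \<in> carrier G \<Longrightarrow> y \<in> carrier G \<Longrightarrow>
     {Inr (pair_node G S 0 (x, y), Left_Arrow), Inr (pair_node G S 0 (y, x), Right_Arrow)}
       \<in> edges (series_graph G S)"
  unfolding edges_series_graph by (rule UnI1, rule UnI2) blast

lemma right_equals_edge:
  "x \<in> carrier G \<Longrightarrow> y \<in> carrier G \<Longrightarrow>
     {Inr (pair_node G S 0 (y, x), Right_Arrow), Inr (pair_node G S 0 (x \<otimes> y, y), Equals_Sign)}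
       \<in> edges (series_graph G S)"
  unfolding edges_series_graph by (rule UnI2) blast

text \<open>A node fixes the leaf below it only up to its coset. The quantifier over
  \<open>q\<close> therefore ranges over all leaves below the node, which yields every child and
  always the same parent.\<close>

lemma internal_adjacent_iff:
  assumes "i \<le> 2 * (length S - 1)" "p \<in> carrier G \<times> carrier G"
  shows "{Inl (pair_node G S i p), Inl w} \<in> edges (series_graph G S) \<longleftrightarrow>
    (\<exists>q \<in> carrier G \<times> carrier G. pair_node G S i q = pair_node G S i p \<and>
      (i < 2 * (length S - 1) \<and> w = pair_node G S (Suc i) q \<or>
       (\<exists>j. i = Suc j \<and> w = pair_node G S j q)))" (is "?L \<longleftrightarrow> ?R")
proof
  assume ?L
  \<comment> \<open>The other three kinds of edges have an \<open>Inr\<close> endpoint, so only a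
    tree edge can join two \<open>Inl\<close> nodes.\<close>
  then have "\<exists>j q. j < 2 * (length S - 1) \<and> q \<in> carrier G \<times> carrier G \<and>
      {Inl (pair_node G S i p) :: 'a graph_node, Inl w} = {Inl (pair_node G S (Suc j) q), Inl (pair_node G S j q)}"
    unfolding edges_series_graph Un_iff mem_Collect_eq
    by (elim disjE exE conjE) (blast | simp add: doubleton_eq_iff)+
  then obtain j q where j: "j < 2 * (length S - 1)" and q: "q \<in> carrier G \<times> carrier G"
    and "{Inl (pair_node G S i p) :: 'a graph_node, Inl w} =
      {Inl (pair_node G S (Suc j) q), Inl (pair_node G S j q)}"
    by blast
  then have eq: "pair_node G S i p = pair_node G S (Suc j) q \<and> w = pair_node G S j q \<or>
      pair_node G S i p = pair_node G S j q \<and> w = pair_node G S (Suc j) q"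
    by (simp add: doubleton_eq_iff)
  from eq show ?R
  proof (elim disjE conjE)
    assume *: "pair_node G S i p = pair_node G S (Suc j) q" "w = pair_node G S j q"
    then have "i = Suc j" using assms j q by (intro pair_node_eq_imp_height_eq[of i p "Suc j" q]) simp_all
    with * q show ?R by (intro bexI[of _ q]) simp_all
  next
    assume *: "pair_node G S i p = pair_node G S j q" "w = pair_node G S (Suc j) q"
    then have "i = j" using assms j q by (intro pair_node_eq_imp_height_eq[of i p j q]) simp_all
    with * q j show ?R by (intro bexI[of _ q]) simp_all
  qed
next
  assume ?R
  then obtain q where q: "q \<in> carrier G \<times> carrier G" "pair_node G S i q = pair_node G S i p"
    and "i < 2 * (length S - 1) \<and> w = pair_node G S (Suc i) q \<or>
       (\<exists>j. i = Suc j \<and> w = pair_node G S j q)" by blast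
  then consider (up) "i < 2 * (length S - 1)" "w = pair_node G S (Suc i) q"
    | (down) j where "i = Suc j" "w = pair_node G S j q" by blast
  then show ?L
  proof cases
    case up
    then have "{Inl (pair_node G S i p) :: 'a graph_node, Inl w} =
        {Inl (pair_node G S (Suc i) q), Inl (pair_node G S i q)}"
      by (simp add: q(2) insert_commute)
    with tree_edge[OF up(1) q(1)] show ?thesis by simp
  next
    case down
    then have "{Inl (pair_node G S i p) :: 'a graph_node, Inl w} =
        {Inl (pair_node G S (Suc j) q), Inl (pair_node G S j q)}"
      using q(2) by simp
    moreover have "j < 2 * (length S - 1)" using down assms(1) by simp
    ultimately show ?thesis using tree_edge[of j q] q(1) by simp
  qed
qed

text \<open>This makes height 0 visible in the colored graph: no internal node of larger height
  touches a gadget leaf, and each gadget leaf has one internal neighbor.\<close>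

lemma leaf_adjacent_iff:
  assumes "i \<le> 2 * (length S - 1)" "p \<in> carrier G \<times> carrier G" "q \<in> carrier G \<times> carrier G"
  shows "{Inl (pair_node G S i p), Inr (pair_node G S 0 q, c)} \<in> edges (series_graph G S) \<longleftrightarrow>
    i = 0 \<and> p = q \<and> c \<noteq> Gadget_Root" (is "?L \<longleftrightarrow> ?R")
proof
  assume ?L
  then obtain r where r: "r \<in> carrier G \<times> carrier G" "pair_node G S i p = pair_node G S 0 r"
      "pair_node G S 0 q = pair_node G S 0 r" "c \<noteq> Gadget_Root"
    unfolding edges_series_graph by (auto simp: doubleton_eq_iff)
  then have "i = 0" using assms by (intro pair_node_eq_imp_height_eq[of i p 0 r]) simp_all
  with r assms show ?R using pair_node_0_eq_iff by simp
next
  assume ?R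
  with leaf_edge[OF assms(2)] show ?L by simp
qed

text \<open>The two colors single out one family of edges and orient it, and nodes of height 0
  determine their pairs. So these edges form the graph of the swap map.\<close>

lemma left_right_adjacent_iff:
  assumes "p \<in> carrier G \<times> carrier G" "q \<in> carrier G \<times> carrier G"
  shows "{Inr (pair_node G S 0 p, Left_Arrow), Inr (pair_node G S 0 q, Right_Arrow)}
      \<in> edges (series_graph G S) \<longleftrightarrow> q = prod.swap p" (is "?L \<longleftrightarrow> ?R")
proof
  assume ?L
  then obtain x y where "x \<in> carrier G" "y \<in> carrier G"
      "pair_node G S 0 p = pair_node G S 0 (x, y)" "pair_node G S 0 q = pair_node G S 0 (y, x)"
    unfolding edges_series_graph by (auto simp: doubleton_eq_iff)
  with assms show ?R by (simp add: pair_node_0_eq_iff)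
next
  assume ?R
  with left_right_edge[of "fst p" "snd p"] assms show ?L by (simp add: mem_Times_iff prod.swap_def)
qed

text \<open>The right node of the path for \<open>x\<close> and \<open>y\<close> is the pair
  \<open>(y, x)\<close>; this is why the factors appear in reversed order of components.\<close>

lemma right_equals_adjacent_iff:
  assumes "p \<in> carrier G \<times> carrier G" "q \<in> carrier G \<times> carrier G"
  shows "{Inr (pair_node G S 0 p, Right_Arrow), Inr (pair_node G S 0 q, Equals_Sign)}
      \<in> edges (series_graph G S) \<longleftrightarrow> q = (snd p \<otimes> fst p, fst p)" (is "?L \<longleftrightarrow> ?R")
proof
  assume ?L
  then obtain x y where "x \<in> carrier G" "y \<in> carrier G"
      "pair_node G S 0 p = pair_node G S 0 (y, x)" "pair_node G S 0 q = pair_node G S 0 (x \<otimes> y, y)"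
    unfolding edges_series_graph by (auto simp: doubleton_eq_iff)
  with assms show ?R by (simp add: pair_node_0_eq_iff)
next
  assume ?R
  with right_equals_edge[of "snd p" "fst p"] assms show ?L by (simp add: mem_Times_iff)
qed

text \<open>The parent does not depend on the leaf chosen below the node. Within a tree this holds
  because cosets of a larger subgroup are unions of cosets of the smaller one; on leaving a lower
  copy, equal first components suffice.\<close>

lemma pair_node_eq_Suc:
  assumes "pair_node G S i p = pair_node G S i q" "i < 2 * (length S - 1)"
    "p \<in> carrier G \<times> carrier G" "q \<in> carrier G \<times> carrier G"
  shows "pair_node G S (Suc i) p = pair_node G S (Suc i) q"
proof (cases "i < length S - 1")
  case True
  then have "fst p = fst q" "snd p <# S ! i = snd q <# S ! i"
    using assms pair_node_eq_iff[of i i p q] by simp_all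
  moreover have "snd p <# S ! Suc i = snd q <# S ! Suc i"
    using True assms by (intro coset_eq_mono calculation) auto
  ultimately show ?thesis by (simp add: pair_node_def)
next
  case False
  then have "fst p <# S ! (i - (length S - 1)) = fst q <# S ! (i - (length S - 1))"
    using assms pair_node_eq_iff[of i i p q] by simp
  then have "fst p <# S ! Suc (i - (length S - 1)) = fst q <# S ! Suc (i - (length S - 1))"
    using False assms by (intro coset_eq_mono) auto
  with False show ?thesis by (simp add: pair_node_def Suc_diff_le)
qed

text \<open>At this height the ancestor is the singleton leaf of the upper tree, so the tree
  structure sees which pairs share their first component.\<close>

lemma pair_node_fst_eq_iff:
  assumes "p \<in> carrier G \<times> carrier G" "q \<in> carrier G \<times> carrier G"
  shows "pair_node G S (length S - 1) p = pair_node G S (length S - 1) q \<longleftrightarrow> fst p = fst q"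
  using assms coset_0 by (auto simp: pair_node_def)

text \<open>At this height the ancestor is the coset of \<open>S ! j\<close> of the first component,
  and a subgroup is the coset of the identity. So each term of the series can be read off from
  ancestors.\<close>

lemma mem_iff_pair_node_eq:
  assumes "j < length S" "x \<in> carrier G"
  shows "x \<in> S ! j \<longleftrightarrow> pair_node G S (length S - 1 + j) (x, x) = pair_node G S (length S - 1 + j) (\<one>, \<one>)"
proof -
  note subgroup = subgroup_S[OF assms(1)]
  have "x <# S ! j = S ! j \<longleftrightarrow> x \<in> S ! j"
    using lcos_self[OF assms(2) subgroup] coset_join3[OF assms(2) subgroup] by blast
  with S_subset[OF assms(1)] show ?thesis
    by (simp add: pair_node_def lcos_mult_one)
qed

section \<open>Recovering the shape of a vertex from its color\<close>

lemma internal_vertexE: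
  assumes "v \<in> vertices (series_graph G S)" "color (series_graph G S) v = Internal"
  obtains i p where "i \<le> 2 * (length S - 1)" "p \<in> carrier G \<times> carrier G"
    "v = Inl (pair_node G S i p)"
proof -
  have "gadget_color c = Internal \<Longrightarrow> c = Gadget_Root" for c by (cases c) auto
  with assms that show thesis
    unfolding vertices_series_graph by (auto simp: color_series_graph)
qed

lemma gadget_vertexE:
  assumes "v \<in> vertices (series_graph G S)" "color (series_graph G S) v = gadget_color c"
    "c \<noteq> Gadget_Root"
  obtains p where "p \<in> carrier G \<times> carrier G" "v = Inr (pair_node G S 0 p, c)"
proof -
  have "gadget_color d = gadget_color c \<Longrightarrow> d = c" for d by (cases c; cases d) auto
  moreover have "Internal \<noteq> gadget_color c" using assms(3) by (cases c) auto
  ultimately show thesis using assms that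
    unfolding vertices_series_graph by (auto simp: color_series_graph)
qed

lemma internal_vertex:
  "i \<le> 2 * (length S - 1) \<Longrightarrow> p \<in> carrier G \<times> carrier G \<Longrightarrow>
     Inl (pair_node G S i p) \<in> vertices (series_graph G S)"
  unfolding vertices_series_graph by blast

lemma gadget_vertex:
  "p \<in> carrier G \<times> carrier G \<Longrightarrow> c \<noteq> Gadget_Root \<Longrightarrow>
     Inr (pair_node G S 0 p, c) \<in> vertices (series_graph G S)"
  unfolding vertices_series_graph by blast

end

subsection \<open>From graph isomorphisms to series isomorphisms\<close>

text \<open>The witness of \<open>colored_isomorphic\<close> gets a predicate of its own, so that
  one map and its inverse can be followed through the argument.\<close>

definition colored_isomorphism ::
  "('v \<Rightarrow> 'w) \<Rightarrow> ('v, 'k) colored_graph \<Rightarrow> ('w, 'k) colored_graph \<Rightarrow> bool" where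
  "colored_isomorphism f X Y \<longleftrightarrow> bij_betw f (vertices X) (vertices Y) \<and>
     (\<forall>u \<in> vertices X. \<forall>v \<in> vertices X. {u, v} \<in> edges X \<longleftrightarrow> {f u, f v} \<in> edges Y) \<and>
     (\<forall>u \<in> vertices X. color Y (f u) = color X u)"

lemma colored_isomorphismD:
  assumes "colored_isomorphism f X Y"
  shows "inj_on f (vertices X)"
    and "u \<in> vertices X \<Longrightarrow> f u \<in> vertices Y"
    and "u \<in> vertices X \<Longrightarrow> v \<in> vertices X \<Longrightarrow> {f u, f v} \<in> edges Y \<longleftrightarrow> {u, v} \<in> edges X"
    and "u \<in> vertices X \<Longrightarrow> color Y (f u) = color X u"
  using assms by (auto simp: colored_isomorphism_def bij_betw_def)

text \<open>Thanks to this symmetry, surjectivity on leaves and equality of lengths follow from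
  one-sided statements.\<close>

lemma colored_isomorphism_inv:
  assumes "colored_isomorphism f X Y"
  shows "colored_isomorphism (inv_into (vertices X) f) Y X"
proof -
  have bij: "bij_betw f (vertices X) (vertices Y)"
    using assms by (simp add: colored_isomorphism_def)
  have "inv_into (vertices X) f u \<in> vertices X" "f (inv_into (vertices X) f u) = u"
    if "u \<in> vertices Y" for u
    using bij that by (auto simp: bij_betw_def inv_into_into f_inv_into_f)
  then show ?thesis
    using bij_betw_inv_into[OF bij] colored_isomorphismD(3,4)[OF assms]
    unfolding colored_isomorphism_def by metis
qed

text \<open>The image of a leaf is internal, and it is still adjacent to nodes of each gadget color,
  which forces height 0. Since a gadget leaf has a unique internal neighbor, one pair
  \<open>q\<close> works for all three colors.\<close>

lemma leaf_image:
  assumes "subgroup_series G S" "subgroup_series H S'"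
    and iso: "colored_isomorphism f (series_graph G S) (series_graph H S')"
    and p: "p \<in> carrier G \<times> carrier G"
  shows "\<exists>q \<in> carrier H \<times> carrier H.
    f (Inl (pair_node G S 0 p)) = Inl (pair_node H S' 0 q) \<and>
    (\<forall>c. c \<noteq> Gadget_Root \<longrightarrow> f (Inr (pair_node G S 0 p, c)) = Inr (pair_node H S' 0 q, c))"
proof -
  interpret X: subgroup_series G S by fact
  interpret Y: subgroup_series H S' by fact
  note fD = colored_isomorphismD[OF iso]
  let ?v = "Inl (pair_node G S 0 p) :: 'a graph_node"
  have v: "?v \<in> vertices (series_graph G S)" using X.internal_vertex[of 0 p] p by simp
  obtain i r where r: "i \<le> 2 * (length S' - 1)" "r \<in> carrier H \<times> carrier H"
      "f ?v = Inl (pair_node H S' i r)"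
    using Y.internal_vertexE[OF fD(2)[OF v]] fD(4)[OF v] by (auto simp: X.color_series_graph)
  have gadget: "i = 0 \<and> f (Inr (pair_node G S 0 p, c)) = Inr (pair_node H S' 0 r, c)"
    if c: "c \<noteq> Gadget_Root" for c
  proof -
    let ?w = "Inr (pair_node G S 0 p, c) :: 'a graph_node"
    have w: "?w \<in> vertices (series_graph G S)" using X.gadget_vertex[OF p c] .
    obtain q where q: "q \<in> carrier H \<times> carrier H" "f ?w = Inr (pair_node H S' 0 q, c)"
      using Y.gadget_vertexE[OF fD(2)[OF w] _ c] fD(4)[OF w] by (auto simp: X.color_series_graph)
    have "{f ?v, f ?w} \<in> edges (series_graph H S')"
      using fD(3)[OF v w] X.leaf_edge[OF p c] by simp
    then show ?thesis
      using Y.leaf_adjacent_iff[OF r(1,2) q(1), of c] q(2) r(3) by simp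
  qed
  with gadget[of Left_Arrow] r show ?thesis by auto
qed

lemma leaf_bijection:
  assumes G: "subgroup_series G S" and H: "subgroup_series H S'"
    and iso: "colored_isomorphism f (series_graph G S) (series_graph H S')"
  obtains g where "bij_betw g (carrier G \<times> carrier G) (carrier H \<times> carrier H)"
    and "\<And>p. p \<in> carrier G \<times> carrier G \<Longrightarrow>
      f (Inl (pair_node G S 0 p)) = Inl (pair_node H S' 0 (g p))"
    and "\<And>p c. p \<in> carrier G \<times> carrier G \<Longrightarrow> c \<noteq> Gadget_Root \<Longrightarrow>
      f (Inr (pair_node G S 0 p, c)) = Inr (pair_node H S' 0 (g p), c)"
proof -
  interpret X: subgroup_series G S by fact
  interpret Y: subgroup_series H S' by fact
  note fD = colored_isomorphismD[OF iso]
  obtain g where g: "\<And>p. p \<in> carrier G \<times> carrier G \<Longrightarrow> g p \<in> carrier H \<times> carrier H"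
      "\<And>p. p \<in> carrier G \<times> carrier G \<Longrightarrow>
        f (Inl (pair_node G S 0 p)) = Inl (pair_node H S' 0 (g p))"
      "\<And>p c. p \<in> carrier G \<times> carrier G \<Longrightarrow> c \<noteq> Gadget_Root \<Longrightarrow>
        f (Inr (pair_node G S 0 p, c)) = Inr (pair_node H S' 0 (g p), c)"
    using leaf_image[OF G H iso] by metis
  have leaf: "Inl (pair_node G S 0 p) \<in> vertices (series_graph G S)"
    if "p \<in> carrier G \<times> carrier G" for p
    using X.internal_vertex[of 0 p] that by simp
  have "inj_on g (carrier G \<times> carrier G)"
  proof (rule inj_onI)
    fix p q assume pq: "p \<in> carrier G \<times> carrier G" "q \<in> carrier G \<times> carrier G" "g p = g q"
    then have "f (Inl (pair_node G S 0 p)) = f (Inl (pair_node G S 0 q))"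
      using g(2) by simp
    then have "Inl (pair_node G S 0 p) = (Inl (pair_node G S 0 q) :: 'a graph_node)"
      using fD(1) leaf pq(1,2) by (simp only: inj_on_eq_iff)
    then show "p = q" using X.pair_node_0_eq_iff[OF pq(1,2)] by simp
  qed
  \<comment> \<open>Surjectivity: the inverse isomorphism also sends leaves to leaves.\<close>
  moreover have "q \<in> g ` (carrier G \<times> carrier G)" if q: "q \<in> carrier H \<times> carrier H" for q
  proof -
    let ?f' = "inv_into (vertices (series_graph G S)) f"
    obtain p where p: "p \<in> carrier G \<times> carrier G"
      "?f' (Inl (pair_node H S' 0 q)) = Inl (pair_node G S 0 p)"
      using leaf_image[OF H G colored_isomorphism_inv[OF iso] q] by blast
    have "Inl (pair_node H S' 0 q) \<in> f ` vertices (series_graph G S)"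
      using Y.internal_vertex[of 0 q] q iso by (simp add: colored_isomorphism_def bij_betw_def)
    then have "Inl (pair_node H S' 0 q) = f (Inl (pair_node G S 0 p))"
      using f_inv_into_f p(2) by metis
    with g(1,2) p(1) q have "q = g p" by (simp add: Y.pair_node_0_eq_iff)
    with p(1) show ?thesis by blast
  qed
  ultimately have "bij_betw g (carrier G \<times> carrier G) (carrier H \<times> carrier H)"
    using g(1) unfolding bij_betw_def by blast
  then show thesis using that g(2,3) by blast
qed

text \<open>The image of a parent is a neighbor of the image of its child, hence the parent of that
  image or one of its children. The second case needs the claim two heights down, hence the strong
  induction. The bound on \<open>i\<close> in the conclusion is carried along to compare the lengths
  later.\<close>

lemma pair_node_image:
  assumes G: "subgroup_series G S" and H: "subgroup_series H S'"
    and iso: "colored_isomorphism f (series_graph G S) (series_graph H S')"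
    and g: "bij_betw g (carrier G \<times> carrier G) (carrier H \<times> carrier H)"
    and leaf: "\<And>p. p \<in> carrier G \<times> carrier G \<Longrightarrow>
      f (Inl (pair_node G S 0 p)) = Inl (pair_node H S' 0 (g p))"
  shows "i \<le> 2 * (length S - 1) \<Longrightarrow> i \<le> 2 * (length S' - 1) \<and>
    (\<forall>p \<in> carrier G \<times> carrier G. f (Inl (pair_node G S i p)) = Inl (pair_node H S' i (g p)))"
proof (induction i rule: less_induct)
  case (less i)
  interpret X: subgroup_series G S by fact
  interpret Y: subgroup_series H S' by fact
  note fD = colored_isomorphismD[OF iso]
  show ?case
  proof (cases i)
    case 0
    with leaf show ?thesis by simp
  next
    case (Suc k)
    then have k: "k < 2 * (length S - 1)" "k < i" using less.prems by simp_all
    have IH: "k \<le> 2 * (length S' - 1)"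
      "p \<in> carrier G \<times> carrier G \<Longrightarrow> f (Inl (pair_node G S k p)) = Inl (pair_node H S' k (g p))" for p
      using less.IH[OF k(2)] less_imp_le[OF k(1)] by blast+
    have main: "Suc k \<le> 2 * (length S' - 1) \<and>
        f (Inl (pair_node G S (Suc k) p)) = Inl (pair_node H S' (Suc k) (g p))"
      if p: "p \<in> carrier G \<times> carrier G" for p
    proof -
      have gp: "g p \<in> carrier H \<times> carrier H" using g p by (auto simp: bij_betw_def)
      let ?u = "Inl (pair_node G S k p) :: 'a graph_node"
      let ?v = "Inl (pair_node G S (Suc k) p) :: 'a graph_node"
      have uv: "?u \<in> vertices (series_graph G S)" "?v \<in> vertices (series_graph G S)"
        using X.internal_vertex[OF _ p] k(1) by simp_all
      obtain j r where r: "f ?v = Inl (pair_node H S' j r)"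
        using Y.internal_vertexE[OF fD(2)[OF uv(2)] trans[OF fD(4)[OF uv(2)] X.color_series_graph(1)]]
        by metis
      have "{f ?v, f ?u} \<in> edges (series_graph H S')"
        using fD(3)[OF uv(2,1)] X.tree_edge[OF k(1) p] by simp
      then have "{Inl (pair_node H S' k (g p)), Inl (pair_node H S' j r)} \<in> edges (series_graph H S')"
        using IH(2)[OF p] r by (simp add: insert_commute)
      then obtain q where q: "q \<in> carrier H \<times> carrier H"
          "pair_node H S' k q = pair_node H S' k (g p)"
        and or: "k < 2 * (length S' - 1) \<and> pair_node H S' j r = pair_node H S' (Suc k) q \<or>
          (\<exists>l. k = Suc l \<and> pair_node H S' j r = pair_node H S' l q)"
        using Y.internal_adjacent_iff[OF IH(1) gp] by blast
      from or show ?thesis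
      proof (elim disjE exE conjE)
        assume "k < 2 * (length S' - 1)" "pair_node H S' j r = pair_node H S' (Suc k) q"
        with r Y.pair_node_eq_Suc[OF q(2) _ q(1) gp] show ?thesis by simp
      next
        \<comment> \<open>Every node of height \<open>l\<close> on the right is already the image of
          a node of height \<open>l\<close>, because \<open>g\<close> is onto. Injectivity of
          \<open>f\<close> would then identify nodes of heights \<open>l\<close> and
          \<open>Suc k\<close>.\<close>
        fix l assume l: "k = Suc l" "pair_node H S' j r = pair_node H S' l q"
        obtain s where s: "s \<in> carrier G \<times> carrier G" "q = g s"
          using g q(1) unfolding bij_betw_def by blast
        have "l < i" "l \<le> 2 * (length S - 1)" using k l by simp_all
        then have "f (Inl (pair_node G S l s)) = Inl (pair_node H S' l q)"
          using less.IH[of l] s by blast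
        then have "f (Inl (pair_node G S l s)) = f ?v" using l(2) r by simp
        moreover have "Inl (pair_node G S l s) \<in> vertices (series_graph G S)"
          by (rule X.internal_vertex) fact+
        ultimately have "Inl (pair_node G S l s) = ?v"
          using fD(1) uv(2) by (simp only: inj_on_eq_iff)
        then have "l = Suc k"
          using k(1) l(1) s(1) p by (intro X.pair_node_eq_imp_height_eq[of l s "Suc k" p]) simp_all
        with l(1) show ?thesis by simp
      qed
    qed
    \<comment> \<open>Some pair must exist for the height bound to be extracted from
      \<open>main\<close>.\<close>
    moreover have "(\<one>\<^bsub>G\<^esub>, \<one>\<^bsub>G\<^esub>) \<in> carrier G \<times> carrier G" by simp
    ultimately show ?thesis using Suc by blast
  qed
qed

text \<open>Taking the root, which has the largest height, in \<open>pair_node_image\<close> bounds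
  the height of one tree by that of the other.\<close>

lemma series_length_le:
  assumes "subgroup_series G S" "subgroup_series H S'"
    "colored_isomorphism f (series_graph G S) (series_graph H S')"
  shows "length S \<le> length S'"
proof -
  interpret X: subgroup_series G S by fact
  interpret Y: subgroup_series H S' by fact
  obtain g where "bij_betw g (carrier G \<times> carrier G) (carrier H \<times> carrier H)"
    "\<And>p. p \<in> carrier G \<times> carrier G \<Longrightarrow>
      f (Inl (pair_node G S 0 p)) = Inl (pair_node H S' 0 (g p))"
    using leaf_bijection[OF assms] by metis
  from pair_node_image[OF assms this, of "2 * (length S - 1)"]
  have "length S - 1 \<le> length S' - 1" by simp
  with Y.S_nonempty show ?thesis by (cases S') auto
qed

lemma series_isomorphic_if_colored_isomorphism:
  assumes G: "subgroup_series G S" and H: "subgroup_series H S'"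
    and iso: "colored_isomorphism f (series_graph G S) (series_graph H S')"
  shows "series_isomorphic G S H S'"
proof -
  interpret X: subgroup_series G S by fact
  interpret Y: subgroup_series H S' by fact
  note fD = colored_isomorphismD[OF iso]
  have len: "length S' = length S"
    using series_length_le[OF G H iso] series_length_le[OF H G colored_isomorphism_inv[OF iso]] by simp
  obtain g where g: "bij_betw g (carrier G \<times> carrier G) (carrier H \<times> carrier H)"
    and leaf: "\<And>p. p \<in> carrier G \<times> carrier G \<Longrightarrow>
      f (Inl (pair_node G S 0 p)) = Inl (pair_node H S' 0 (g p))"
    and gadget: "\<And>p c. p \<in> carrier G \<times> carrier G \<Longrightarrow> c \<noteq> Gadget_Root \<Longrightarrow>
      f (Inr (pair_node G S 0 p, c)) = Inr (pair_node H S' 0 (g p), c)"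
    using leaf_bijection[OF G H iso] by metis
  have g_mem: "g p \<in> carrier H \<times> carrier H" if "p \<in> carrier G \<times> carrier G" for p
    using g that unfolding bij_betw_def by blast
  \<comment> \<open>From here on the tree enters only through these equivalences: \<open>g\<close>
    preserves and reflects having the same ancestor at each height.\<close>
  have eq_iff: "pair_node H S' i (g p) = pair_node H S' i (g q) \<longleftrightarrow> pair_node G S i p = pair_node G S i q"
    if "i \<le> 2 * (length S - 1)" "p \<in> carrier G \<times> carrier G" "q \<in> carrier G \<times> carrier G" for i p q
  proof -
    let ?u = "Inl (pair_node G S i p) :: 'a graph_node"
    let ?v = "Inl (pair_node G S i q) :: 'a graph_node"
    have "f ?u = Inl (pair_node H S' i (g p))" "f ?v = Inl (pair_node H S' i (g q))"
      using pair_node_image[OF G H iso g leaf that(1)] that(2,3) by blast+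
    moreover have "f ?u = f ?v \<longleftrightarrow> ?u = ?v"
      using fD(1) X.internal_vertex that by (intro inj_on_eq_iff) auto
    ultimately show ?thesis by simp
  qed
  have swap: "g (prod.swap p) = prod.swap (g p)" if p: "p \<in> carrier G \<times> carrier G" for p
  proof -
    let ?u = "Inr (pair_node G S 0 p, Left_Arrow) :: 'a graph_node"
    let ?v = "Inr (pair_node G S 0 (prod.swap p), Right_Arrow) :: 'a graph_node"
    have p': "prod.swap p \<in> carrier G \<times> carrier G" using p by auto
    have "{f ?u, f ?v} \<in> edges (series_graph H S')"
      using fD(3)[of ?u ?v] X.gadget_vertex[OF p] X.gadget_vertex[OF p']
        X.left_right_adjacent_iff[OF p p'] by simp
    then show ?thesis
      using gadget[OF p] gadget[OF p'] Y.left_right_adjacent_iff[OF g_mem[OF p] g_mem[OF p']] by simp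
  qed
  have mult: "g (snd p \<otimes>\<^bsub>G\<^esub> fst p, fst p) = (snd (g p) \<otimes>\<^bsub>H\<^esub> fst (g p), fst (g p))"
    if p: "p \<in> carrier G \<times> carrier G" for p
  proof -
    let ?q = "(snd p \<otimes>\<^bsub>G\<^esub> fst p, fst p)"
    let ?u = "Inr (pair_node G S 0 p, Right_Arrow) :: 'a graph_node"
    let ?v = "Inr (pair_node G S 0 ?q, Equals_Sign) :: 'a graph_node"
    have q: "?q \<in> carrier G \<times> carrier G" using p by auto
    have "{f ?u, f ?v} \<in> edges (series_graph H S')"
      using fD(3)[of ?u ?v] X.gadget_vertex[OF p] X.gadget_vertex[OF q]
        X.right_equals_adjacent_iff[OF p q] by simp
    then show ?thesis
      using gadget[OF p] gadget[OF q] Y.right_equals_adjacent_iff[OF g_mem[OF p] g_mem[OF q]] by simp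
  qed
  \<comment> \<open>The identity is an arbitrary second component; height
    \<open>length S - 1\<close> shows that the value does not depend on it.\<close>
  define \<phi> where "\<phi> x = fst (g (x, \<one>\<^bsub>G\<^esub>))" for x
  have fst_g: "fst (g (x, y)) = \<phi> x" if "x \<in> carrier G" "y \<in> carrier G" for x y
  proof -
    have "(x, y) \<in> carrier G \<times> carrier G" "(x, \<one>\<^bsub>G\<^esub>) \<in> carrier G \<times> carrier G"
      using that by simp_all
    then show ?thesis
      using eq_iff[of "length S - 1" "(x, y)" "(x, \<one>\<^bsub>G\<^esub>)"] X.pair_node_fst_eq_iff Y.pair_node_fst_eq_iff
        g_mem len unfolding \<phi>_def by auto
  qed
  have g_eq: "g (x, y) = (\<phi> x, \<phi> y)" if "x \<in> carrier G" "y \<in> carrier G" for x y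
    \<comment> \<open>The second component of \<open>g (x, y)\<close> is the first component of
      \<open>g (y, x)\<close>.\<close>
    using fst_g[OF that] fst_g[OF that(2,1)] swap[of "(x, y)"] that by (cases "g (x, y)") simp
  have \<phi>_mem: "\<phi> x \<in> carrier H" if "x \<in> carrier G" for x
    using g_mem[of "(x, x)"] g_eq[OF that that] that by simp
  have hom: "\<phi> \<in> hom G H"
    \<comment> \<open>At \<open>(y, x)\<close>, comparing first components in \<open>mult\<close> is
      the homomorphism law for the product of \<open>x\<close> and \<open>y\<close>.\<close>
    using mult[of "(y, x)" for x y] by (intro homI \<phi>_mem) (auto simp: g_eq)
  have bij: "bij_betw \<phi> (carrier G) (carrier H)"
  proof (intro bij_betw_imageI inj_onI equalityI subsetI)
    fix x y assume "x \<in> carrier G" "y \<in> carrier G" "\<phi> x = \<phi> y"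
    then have "g (x, x) = g (y, y)" by (simp add: g_eq)
    with g \<open>x \<in> carrier G\<close> \<open>y \<in> carrier G\<close> show "x = y"
      unfolding bij_betw_def by (auto dest: inj_onD)
  next
    fix h assume "h \<in> carrier H"
    then have "(h, h) \<in> g ` (carrier G \<times> carrier G)"
      using g unfolding bij_betw_def by blast
    then show "h \<in> \<phi> ` carrier G" by (auto simp: g_eq)
  qed (use \<phi>_mem in blast)
  have one: "\<phi> \<one>\<^bsub>G\<^esub> = \<one>\<^bsub>H\<^esub>"
    using hom hom_one X.is_group Y.is_group by blast
  have image: "\<phi> ` (S ! j) = S' ! j" if j: "j < length S" for j
  proof -
    have i: "length S - 1 + j \<le> 2 * (length S - 1)" using j by simp
    have mem: "\<phi> x \<in> S' ! j \<longleftrightarrow> x \<in> S ! j" if x: "x \<in> carrier G" for x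
      using X.mem_iff_pair_node_eq[OF j x] Y.mem_iff_pair_node_eq[OF _ \<phi>_mem[OF x], of j]
        eq_iff[OF i, of "(x, x)" "(\<one>\<^bsub>G\<^esub>, \<one>\<^bsub>G\<^esub>)"] j len x by (simp add: g_eq one)
    \<comment> \<open>Surjectivity of \<open>\<phi>\<close> ensures that the membership test
      \<open>mem\<close> reaches every element of \<open>S' ! j\<close>.\<close>
    have "S ! j \<subseteq> carrier G" "S' ! j \<subseteq> \<phi> ` carrier G"
      using X.S_subset Y.S_subset j len bij unfolding bij_betw_def by simp_all
    with mem show ?thesis by blast
  qed
  show ?thesis
    unfolding series_isomorphic_def iso_def using hom bij len image by auto
qed

subsection \<open>From series isomorphisms to graph isomorphisms\<close>

text \<open>Cosets and leaves are both encoded as sets of group elements, so taking images handles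
  them alike; the gadget component stays fixed.\<close>

definition relabel :: "('a \<Rightarrow> 'b) \<Rightarrow> 'a graph_node \<Rightarrow> 'b graph_node" where
  "relabel \<phi> = map_sum (map_sum (image \<phi>) (map_prod (image \<phi>) (image \<phi>)))
     (map_prod (map_sum (image \<phi>) (map_prod (image \<phi>) (image \<phi>))) id)"

lemma hom_image_l_coset:
  assumes "\<phi> \<in> hom G H" "x \<in> carrier G" "A \<subseteq> carrier G"
  shows "\<phi> ` (x <#\<^bsub>G\<^esub> A) = \<phi> x <#\<^bsub>H\<^esub> (\<phi> ` A)"
proof -
  have "\<phi> (x \<otimes>\<^bsub>G\<^esub> a) = \<phi> x \<otimes>\<^bsub>H\<^esub> \<phi> a" if "a \<in> A" for a
    using assms that by (intro hom_mult) auto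
  then show ?thesis by (auto simp: l_coset_def image_iff)
qed

text \<open>Stated for homomorphisms, so that an isomorphism and its inverse are both instances and
  each fact can be used in both directions.\<close>

locale subgroup_series_hom = X: subgroup_series G S + Y: subgroup_series H S'
  for G :: "('a, 'c) monoid_scheme" and S and H :: "('b, 'd) monoid_scheme" and S' +
  fixes \<phi>
  assumes hom: "\<phi> \<in> hom G H"
    and length_eq: "length S' = length S"
    and image_S: "i < length S \<Longrightarrow> \<phi> ` (S ! i) = S' ! i"
begin

lemma \<phi>_mem: "x \<in> carrier G \<Longrightarrow> \<phi> x \<in> carrier H"
  using hom by (rule hom_in_carrier)

lemma image_coset:
  "x \<in> carrier G \<Longrightarrow> i < length S \<Longrightarrow> \<phi> ` (x <#\<^bsub>G\<^esub> S ! i) = \<phi> x <#\<^bsub>H\<^esub> S' ! i"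
  using hom_image_l_coset[OF hom _ X.S_subset] image_S by simp

lemma relabel_pair_node:
  assumes "i \<le> 2 * (length S - 1)" "p \<in> carrier G \<times> carrier G"
  shows "relabel \<phi> (Inl (pair_node G S i p)) = Inl (pair_node H S' i (map_prod \<phi> \<phi> p))"
    and "relabel \<phi> (Inr (pair_node G S i p, c)) = Inr (pair_node H S' i (map_prod \<phi> \<phi> p), c)"
proof -
  obtain x y where p: "p = (x, y)" "x \<in> carrier G" "y \<in> carrier G" using assms(2) by auto
  have "i - (length S - 1) < length S" using assms(1) X.S_nonempty by (cases S; simp)
  then have "map_sum (image \<phi>) (map_prod (image \<phi>) (image \<phi>)) (pair_node G S i p) =
      pair_node H S' i (map_prod \<phi> \<phi> p)"
    using p by (simp add: pair_node_def length_eq image_coset)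
  then show "relabel \<phi> (Inl (pair_node G S i p)) = Inl (pair_node H S' i (map_prod \<phi> \<phi> p))"
    "relabel \<phi> (Inr (pair_node G S i p, c)) = Inr (pair_node H S' i (map_prod \<phi> \<phi> p), c)"
    by (simp_all add: relabel_def)
qed

lemma map_prod_mem: "p \<in> carrier G \<times> carrier G \<Longrightarrow> map_prod \<phi> \<phi> p \<in> carrier H \<times> carrier H"
  using \<phi>_mem by (cases p) simp

lemma relabel_vertex:
  assumes "v \<in> vertices (series_graph G S)"
  shows "relabel \<phi> v \<in> vertices (series_graph H S')"
proof -
  from assms consider (internal) i p where "i \<le> 2 * (length S - 1)" "p \<in> carrier G \<times> carrier G"
      "v = Inl (pair_node G S i p)"
    | (gadget) p c where "p \<in> carrier G \<times> carrier G" "c \<noteq> Gadget_Root" "v = Inr (pair_node G S 0 p, c)"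
    unfolding X.vertices_series_graph by blast
  then show ?thesis
  proof cases
    case internal
    then show ?thesis
      using Y.internal_vertex[OF _ map_prod_mem] by (simp add: relabel_pair_node(1) length_eq)
  next
    case gadget
    then show ?thesis
      using Y.gadget_vertex[OF map_prod_mem] by (simp add: relabel_pair_node(2))
  qed
qed

lemma color_relabel: "color (series_graph H S') (relabel \<phi> v) = color (series_graph G S) v"
  by (cases v) (auto simp: relabel_def series_graph_def)

text \<open>Each kind of edge goes to an edge of the same kind; for the edges that encode products
  this is multiplicativity of \<open>\<phi>\<close>.\<close>

lemma relabel_edge:
  assumes "e \<in> edges (series_graph G S)"
  shows "relabel \<phi> ` e \<in> edges (series_graph H S')"
  using assms unfolding X.edges_series_graph Un_iff mem_Collect_eq
proof (elim disjE exE conjE)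
  fix i p assume "i < 2 * (length S - 1)" "p \<in> carrier G \<times> carrier G"
    "e = {Inl (pair_node G S (Suc i) p), Inl (pair_node G S i p)}"
  with Y.tree_edge[OF _ map_prod_mem, of i p] show ?thesis
    by (simp add: relabel_pair_node(1) length_eq)
next
  fix p c assume "p \<in> carrier G \<times> carrier G" "c \<noteq> Gadget_Root"
    "e = {Inl (pair_node G S 0 p), Inr (pair_node G S 0 p, c)}"
  with Y.leaf_edge[OF map_prod_mem, of p c] show ?thesis
    by (simp add: relabel_pair_node)
next
  fix x y assume "x \<in> carrier G" "y \<in> carrier G"
    "e = {Inr (pair_node G S 0 (x, y), Left_Arrow), Inr (pair_node G S 0 (y, x), Right_Arrow)}"
  with Y.left_right_edge[OF \<phi>_mem \<phi>_mem, of x y] show ?thesis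
    by (simp add: relabel_pair_node(2))
next
  fix x y assume "x \<in> carrier G" "y \<in> carrier G"
    "e = {Inr (pair_node G S 0 (y, x), Right_Arrow),
          Inr (pair_node G S 0 (x \<otimes>\<^bsub>G\<^esub> y, y), Equals_Sign)}"
  with Y.right_equals_edge[OF \<phi>_mem \<phi>_mem, of x y] show ?thesis
    by (simp add: relabel_pair_node(2) hom_mult[OF hom])
qed

end

lemma relabel_inverse:
  assumes "subgroup_series_hom G S H S' \<phi>" "subgroup_series_hom H S' G S \<psi>"
    and inverse: "\<And>x. x \<in> carrier G \<Longrightarrow> \<psi> (\<phi> x) = x"
    and v: "v \<in> vertices (series_graph G S)"
  shows "relabel \<psi> (relabel \<phi> v) = v"
proof -
  interpret A: subgroup_series_hom G S H S' \<phi> by fact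
  interpret B: subgroup_series_hom H S' G S \<psi> by fact
  have p: "map_prod \<psi> \<psi> (map_prod \<phi> \<phi> p) = p" if "p \<in> carrier G \<times> carrier G" for p
    using that inverse by auto
  from v consider (internal) i p where "i \<le> 2 * (length S - 1)" "p \<in> carrier G \<times> carrier G"
      "v = Inl (pair_node G S i p)"
    | (gadget) p c where "p \<in> carrier G \<times> carrier G" "v = Inr (pair_node G S 0 p, c)"
    unfolding A.X.vertices_series_graph by blast
  then show ?thesis
  proof cases
    case internal
    then show ?thesis
      using A.relabel_pair_node(1) B.relabel_pair_node(1)[OF _ A.map_prod_mem] p
      by (simp add: A.length_eq)
  next
    case gadget
    then show ?thesis
      using A.relabel_pair_node(2) B.relabel_pair_node(2)[OF _ A.map_prod_mem] p by simp
  qed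
qed

lemma colored_isomorphism_relabel:
  assumes "subgroup_series_hom G S H S' \<phi>" "subgroup_series_hom H S' G S \<psi>"
    and "\<And>x. x \<in> carrier G \<Longrightarrow> \<psi> (\<phi> x) = x" "\<And>y. y \<in> carrier H \<Longrightarrow> \<phi> (\<psi> y) = y"
  shows "colored_isomorphism (relabel \<phi>) (series_graph G S) (series_graph H S')"
proof -
  interpret A: subgroup_series_hom G S H S' \<phi> by fact
  interpret B: subgroup_series_hom H S' G S \<psi> by fact
  have inv: "relabel \<psi> (relabel \<phi> v) = v" if "v \<in> vertices (series_graph G S)" for v
    using relabel_inverse[OF assms(1,2)] assms(3) that by metis
  have inv': "relabel \<phi> (relabel \<psi> w) = w" if "w \<in> vertices (series_graph H S')" for w
    using relabel_inverse[OF assms(2,1)] assms(4) that by metis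
  have "bij_betw (relabel \<phi>) (vertices (series_graph G S)) (vertices (series_graph H S'))"
    using inv inv' A.relabel_vertex B.relabel_vertex
    by (intro bij_betw_byWitness[where f' = "relabel \<psi>"]) blast+
  moreover have "{u, v} \<in> edges (series_graph G S) \<longleftrightarrow>
      {relabel \<phi> u, relabel \<phi> v} \<in> edges (series_graph H S')"
    if "u \<in> vertices (series_graph G S)" "v \<in> vertices (series_graph G S)" for u v
    \<comment> \<open>The converse direction applies the inverse relabeling to the image
      edge.\<close>
    using A.relabel_edge[of "{u, v}"] B.relabel_edge[of "{relabel \<phi> u, relabel \<phi> v}"]
      inv[OF that(1)] inv[OF that(2)] by auto
  ultimately show ?thesis
    by (simp add: colored_isomorphism_def A.color_relabel)
qed

lemma colored_isomorphic_if_series_isomorphic: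
  assumes G: "subgroup_series G S" and H: "subgroup_series H S'"
    and iso: "series_isomorphic G S H S'"
  shows "\<exists>f. colored_isomorphism f (series_graph G S) (series_graph H S')"
proof -
  interpret X: subgroup_series G S by fact
  interpret Y: subgroup_series H S' by fact
  from iso obtain \<phi> where \<phi>: "\<phi> \<in> iso G H" and len: "length S = length S'"
    and image: "\<And>i. i < length S \<Longrightarrow> \<phi> ` (S ! i) = S' ! i"
    unfolding series_isomorphic_def by blast
  define \<psi> where "\<psi> = inv_into (carrier G) \<phi>"
  have \<psi>: "\<psi> \<in> iso H G" unfolding \<psi>_def by (rule X.iso_set_sym[OF \<phi>])
  have bij: "bij_betw \<phi> (carrier G) (carrier H)" using \<phi> by (simp add: iso_def)
  have inv: "\<psi> (\<phi> x) = x" if "x \<in> carrier G" for x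
    using bij_betw_inv_into_left[OF bij that] by (simp add: \<psi>_def)
  have inv': "\<phi> (\<psi> y) = y" if "y \<in> carrier H" for y
    using bij_betw_inv_into_right[OF bij that] by (simp add: \<psi>_def)
  have image': "\<psi> ` (S' ! i) = S ! i" if i: "i < length S'" for i
  proof -
    have "\<psi> ` \<phi> ` (S ! i) = S ! i"
      using X.S_subset[of i] i len inv by (force simp: image_image)
    with image[of i] i len show ?thesis by simp
  qed
  have "subgroup_series_hom G S H S' \<phi>"
    by unfold_locales (use \<phi> len image in \<open>auto simp: iso_def\<close>)
  moreover have "subgroup_series_hom H S' G S \<psi>"
    by unfold_locales (use \<psi> len image' in \<open>auto simp: iso_def\<close>)
  ultimately show ?thesis using colored_isomorphism_relabel inv inv' by blast
qed

text \<open>Normality in the next term contains the inclusion of carriers, and distinctness of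
  consecutive terms makes it strict.\<close>

lemma subgroup_series_if_subnormal_series:
  assumes "group G" "finite (carrier G)" "subnormal_series G S"
  shows "subgroup_series G S"
proof -
  interpret group G by fact
  show ?thesis
  proof (intro subgroup_series.intro subgroup_series_axioms.intro)
    show "subgroup (S ! i) G" if "i < length S" for i
      using assms(3) that by (simp add: subnormal_series_def)
    show "S ! i \<subset> S ! Suc i" if "Suc i < length S" for i
    proof -
      have "S ! i \<lhd> G\<lparr>carrier := S ! Suc i\<rparr>" "S ! i \<noteq> S ! Suc i"
        using assms(3) that by (simp_all add: subnormal_series_def)
      then show ?thesis
        using subgroup.subset[OF normal_imp_subgroup] by fastforce
    qed
  qed (use assms in \<open>auto simp: subnormal_series_def\<close>)
qed

theorem corollary4p10:
  fixes G :: "('a, 'c) monoid_scheme" and H :: "('b, 'd) monoid_scheme"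
    and S :: "'a set list" and S' :: "'b set list"
  assumes "group G" and "finite (carrier G)" and "composition_series G S"
    and "group H" and "finite (carrier H)" and "composition_series H S'"
  shows "series_isomorphic G S H S' \<longleftrightarrow>
    colored_isomorphic (series_graph G S) (series_graph H S')"
proof -
  have GS: "subgroup_series G S" and HS: "subgroup_series H S'"
    using assms subgroup_series_if_subnormal_series unfolding composition_series_def by blast+
  have "colored_isomorphic (series_graph G S) (series_graph H S') \<longleftrightarrow>
      (\<exists>f. colored_isomorphism f (series_graph G S) (series_graph H S'))"
    by (simp add: colored_isomorphic_def colored_isomorphism_def)
  then show ?thesis
    using series_isomorphic_if_colored_isomorphism[OF GS HS]
      colored_isomorphic_if_series_isomorphic[OF GS HS] by blast
qed

end
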